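(* Let $X,Y$ be topological spaces, let $f:X\to Y$ be a continuous map, and let $\rho_f:E_f\to Y$ be its associated path fibration. Then $\mathrm{cat}(f)=\mathrm{cat}(\rho_f)$.
   Context: $\mathrm{Map}([0,1],Y)$ is the space of continuous paths $[0,1]\to Y$ with the compact-open topology. For a continuous map $f:X\to Y$, put $E_f=\{(x,\gamma)\in X\times\mathrm{Map}([0,1],Y):\gamma(0)=f(x)\}$ (subspace topology of the product), and $\rho_f:E_f\to Y$, $\rho_f(x,\gamma)=\gamma(1)$. A continuous map is null-homotopic if it is (freely) homotopic to a constant map. The category $\mathrm{cat}(f)$ of a continuous map $f:X\to Y$ is the least positive integer $n$ such that $X$ is a union of open subsets $U_1,\dots,U_n$ with each restriction $f_{|U_i}:U_i\to Y$ null-homotopic, and $\infty$ if no such integer exists. *)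

theory Defs
  imports "HOL-Analysis.Analysis" "HOL-Library.Extended_Nat"
begin

text \<open>Maps are represented by functions that are undefined outside the domain, so that a
  continuous map on \<open>topspace X\<close> corresponds to exactly one element of the mapping space.\<close>

definition cont_maps :: "'a topology \<Rightarrow> 'b topology \<Rightarrow> ('a \<Rightarrow> 'b) set"
  where "cont_maps X Y = {g \<in> extensional (topspace X). continuous_map X Y g}"

definition compact_open_topology :: "'a topology \<Rightarrow> 'b topology \<Rightarrow> ('a \<Rightarrow> 'b) topology"
  where "compact_open_topology X Y =
    topology_generated_by {{g \<in> cont_maps X Y. g ` K \<subseteq> U} | K U. compactin X K \<and> openin Y U}"

lemma topspace_compact_open_topology [simp]:
  "topspace (compact_open_topology X Y) = cont_maps X Y"
proof -
  have "cont_maps X Y \<in> {{g \<in> cont_maps X Y. g ` K \<subseteq> U} | K U. compactin X K \<and> openin Y U}"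
    by (rule CollectI, rule exI[of _ "{}"], rule exI[of _ "{}"]) auto
  then show ?thesis
    unfolding compact_open_topology_def topology_generated_by_topspace by blast
qed

definition path_mapping_space :: "'b topology \<Rightarrow> (real \<Rightarrow> 'b) topology"
  where "path_mapping_space Y = compact_open_topology (top_of_set {0..1}) Y"

definition path_fibration_space ::
    "'a topology \<Rightarrow> 'b topology \<Rightarrow> ('a \<Rightarrow> 'b) \<Rightarrow> ('a \<times> (real \<Rightarrow> 'b)) topology"
  where "path_fibration_space X Y f =
    subtopology (prod_topology X (path_mapping_space Y)) {(x, \<gamma>). \<gamma> 0 = f x}"

text \<open>The formula for \<open>\<rho>\<^sub>f\<close> does not involve \<open>f\<close>; only its domain
  \<open>path_fibration_space X Y f\<close> does.\<close>

definition path_fibration :: "'a \<times> (real \<Rightarrow> 'b) \<Rightarrow> 'b"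
  where "path_fibration = (\<lambda>(x, \<gamma>). \<gamma> 1)"

text \<open>If the domain is nonempty, the homotopy forces \<open>c \<in> topspace Y\<close>. The empty map
  counts as null-homotopic, even into the empty space.\<close>

definition null_homotopic :: "'a topology \<Rightarrow> 'b topology \<Rightarrow> ('a \<Rightarrow> 'b) \<Rightarrow> bool"
  where "null_homotopic X Y f \<longleftrightarrow> (\<exists>c. homotopic_with (\<lambda>h. True) X Y f (\<lambda>x. c))"

definition has_categorical_cover :: "'a topology \<Rightarrow> 'b topology \<Rightarrow> ('a \<Rightarrow> 'b) \<Rightarrow> nat \<Rightarrow> bool"
  where "has_categorical_cover X Y f n \<longleftrightarrow>
    (\<exists>U :: nat \<Rightarrow> 'a set.
       (\<forall>i\<in>{1..n}. openin X (U i) \<and> null_homotopic (subtopology X (U i)) Y f) \<and>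
       topspace X = (\<Union>i\<in>{1..n}. U i))"

definition map_category :: "'a topology \<Rightarrow> 'b topology \<Rightarrow> ('a \<Rightarrow> 'b) \<Rightarrow> enat"
  where "map_category X Y f =
    (if \<exists>n>0. has_categorical_cover X Y f n
     then enat (LEAST n. n > 0 \<and> has_categorical_cover X Y f n)
     else \<infinity>)"

end

theory Submission
  imports Defs
begin

text \<open>Call a map \<open>g\<close> into \<open>Y\<close> dominated by \<open>f\<close> if \<open>g\<close> is homotopic to \<open>f \<circ> \<phi>\<close> for some
  continuous \<open>\<phi>\<close>; a categorical cover for \<open>f\<close> then pulls back along \<open>\<phi>\<close> to one for \<open>g\<close>.
  The maps \<open>f\<close> and \<open>\<rho>\<^sub>f\<close> dominate each other: \<open>f\<close> equals \<open>\<rho>\<^sub>f\<close> composed with the section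
  of constant paths, and sliding along the paths deforms \<open>f \<circ> fst\<close> into \<open>\<rho>\<^sub>f\<close>.\<close>

lemma null_homotopic_compose:
  assumes "null_homotopic X Y f" "continuous_map X' X \<phi>"
  shows "null_homotopic X' Y (f \<circ> \<phi>)"
proof -
  obtain c where "homotopic_with (\<lambda>h. True) X Y f (\<lambda>x. c)"
    using assms(1) unfolding null_homotopic_def by blast
  then have "homotopic_with (\<lambda>h. True) X' Y (f \<circ> \<phi>) ((\<lambda>x. c) \<circ> \<phi>)"
    by (rule homotopic_with_compose_continuous_map_right) (use assms(2) in auto)
  then show ?thesis
    unfolding null_homotopic_def comp_def by blast
qed

lemma null_homotopic_homotopic:
  assumes "null_homotopic X Y f" "homotopic_with (\<lambda>h. True) X Y g f"
  shows "null_homotopic X Y g"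
  using assms homotopic_with_trans unfolding null_homotopic_def by blast

lemma has_categorical_cover_pullback:
  assumes cover: "has_categorical_cover X Y f n"
    and \<phi>: "continuous_map X' X \<phi>"
    and hom: "homotopic_with (\<lambda>h. True) X' Y g (f \<circ> \<phi>)"
  shows "has_categorical_cover X' Y g n"
proof -
  obtain U where U: "\<And>i. i \<in> {1..n} \<Longrightarrow> openin X (U i)"
      "\<And>i. i \<in> {1..n} \<Longrightarrow> null_homotopic (subtopology X (U i)) Y f"
      "topspace X = (\<Union>i\<in>{1..n}. U i)"
    using cover unfolding has_categorical_cover_def by blast
  define V where "V i = {x \<in> topspace X'. \<phi> x \<in> U i}" for i
  have "openin X' (V i)" if "i \<in> {1..n}" for i
    unfolding V_def by (rule openin_continuous_map_preimage [OF \<phi> U(1) [OF that]])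
  moreover have "null_homotopic (subtopology X' (V i)) Y g" if "i \<in> {1..n}" for i
  proof (rule null_homotopic_homotopic)
    have "continuous_map (subtopology X' (V i)) (subtopology X (U i)) \<phi>"
      using \<phi> by (auto simp: continuous_map_in_subtopology V_def
          intro: continuous_map_from_subtopology)
    then show "null_homotopic (subtopology X' (V i)) Y (f \<circ> \<phi>)"
      by (rule null_homotopic_compose [OF U(2) [OF that]])
    \<comment> \<open>Restricting the homotopy \<open>hom\<close> to \<open>V i\<close> is
      precomposing it with the inclusion, that is, with \<open>id\<close> on the
      subtopology.\<close>
    show "homotopic_with (\<lambda>h. True) (subtopology X' (V i)) Y g (f \<circ> \<phi>)"
      using homotopic_with_compose_continuous_map_right
        [OF hom continuous_map_from_subtopology [OF continuous_map_id], of "\<lambda>h. True" "V i"]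
      by (simp add: id_def comp_def)
  qed
  moreover have "topspace X' = (\<Union>i\<in>{1..n}. V i)"
    using U(3) continuous_map_funspace [OF \<phi>] by (fastforce simp: V_def Pi_iff)
  ultimately show ?thesis
    unfolding has_categorical_cover_def by blast
qed

lemma openin_compact_open_subbasis:
  assumes "compactin X K" "openin Y U"
  shows "openin (compact_open_topology X Y) {g \<in> cont_maps X Y. g ` K \<subseteq> U}"
  unfolding compact_open_topology_def
  by (rule topology_generated_by_Basis) (use assms in blast)

lemma topspace_path_mapping_space [simp]:
  "topspace (path_mapping_space Y) = cont_maps (top_of_set {0..1}) Y"
  by (simp add: path_mapping_space_def)

text \<open>Local compactness of the unit interval makes evaluation jointly continuous: a path
  sending s into W sends a whole compact neighbourhood of s into W, and for paths that is an open
  condition in the compact-open topology.\<close>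

lemma continuous_map_path_evaluation:
  "continuous_map (prod_topology (top_of_set {0..1}) (path_mapping_space Y)) Y (\<lambda>(t, \<gamma>). \<gamma> t)"
    (is "continuous_map ?P Y ?ev")
  unfolding continuous_map_def
proof (intro conjI allI impI)
  show "?ev \<in> topspace ?P \<rightarrow> topspace Y"
    by (auto simp: cont_maps_def continuous_map_def Pi_iff)
next
  fix W assume W: "openin Y W"
  show "openin ?P {p \<in> topspace ?P. ?ev p \<in> W}"
  proof (subst openin_subopen, intro ballI)
    fix p assume p: "p \<in> {p \<in> topspace ?P. ?ev p \<in> W}"
    obtain s \<gamma> where [simp]: "p = (s, \<gamma>)"
      by (cases p)
    have s: "s \<in> {0..1}" and \<gamma>: "\<gamma> \<in> cont_maps (top_of_set {0..1}) Y" and "\<gamma> s \<in> W"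
      using p by auto
    have "openin (top_of_set {0..1}) {t \<in> {0..1}. \<gamma> t \<in> W}"
      using openin_continuous_map_preimage [of "top_of_set {0..1}" Y \<gamma> W] \<gamma> W
      by (simp add: cont_maps_def)
    \<comment> \<open>Two balls of the same radius are used: the closed one is compact in the
      interval and so defines the subbasic set \<open>N\<close> of paths, while the open one
      supplies the neighbourhood of \<open>s\<close> in the product.\<close>
    then obtain e where "e > 0" and e: "cball s e \<inter> {0..1} \<subseteq> {t \<in> {0..1}. \<gamma> t \<in> W}"
      unfolding openin_contains_cball using s \<open>\<gamma> s \<in> W\<close> by blast
    define N where "N = {\<gamma> \<in> cont_maps (top_of_set {0..1}) Y. \<gamma> ` (cball s e \<inter> {0..1}) \<subseteq> W}"
    have "openin (path_mapping_space Y) N"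
      unfolding N_def path_mapping_space_def using W
      by (intro openin_compact_open_subbasis)
        (auto simp: compactin_subtopology)
    moreover have "openin (top_of_set {0..1}) ({0..1} \<inter> ball s e)"
      by (simp add: openin_open_Int)
    ultimately have "openin ?P (({0..1} \<inter> ball s e) \<times> N)"
      by (simp add: openin_prod_Times_iff)
    moreover have "p \<in> ({0..1} \<inter> ball s e) \<times> N"
      using s \<gamma> e \<open>e > 0\<close> by (auto simp: N_def)
    moreover have "({0..1} \<inter> ball s e) \<times> N \<subseteq> {p \<in> topspace ?P. ?ev p \<in> W}"
      using ball_subset_cball [of s e] by (fastforce simp: N_def)
    ultimately show "\<exists>T. openin ?P T \<and> p \<in> T \<and> T \<subseteq> {p \<in> topspace ?P. ?ev p \<in> W}"
      by blast
  qed
qed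

text \<open>On a nonempty K a constant map takes just its one value, so the preimage of the subbasic
  set given by K and U is U itself.\<close>

lemma continuous_map_constant_maps:
  "continuous_map Y (compact_open_topology X Y) (\<lambda>y. restrict (\<lambda>x. y) (topspace X))"
    (is "continuous_map Y ?M ?k")
proof -
  have k: "?k y \<in> cont_maps X Y" if "y \<in> topspace Y" for y
    using that by (auto simp: cont_maps_def intro: continuous_map_eq [of X Y "\<lambda>x. y"])
  show ?thesis
    unfolding compact_open_topology_def
  proof (rule continuous_on_generated_topo)
    fix S assume "S \<in> {{g \<in> cont_maps X Y. g ` K \<subseteq> U} | K U. compactin X K \<and> openin Y U}"
    then obtain K U where S: "S = {g \<in> cont_maps X Y. g ` K \<subseteq> U}"
        and "compactin X K" and U: "openin Y U"
      by blast
    then have "K \<subseteq> topspace X"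
      by (simp add: compactin_subset_topspace)
    \<comment> \<open>For empty K the condition on the image is vacuous, hence the separate
      case.\<close>
    then have "?k -` S \<inter> topspace Y = (if K = {} then topspace Y else U)"
      using k openin_subset [OF U] by (auto simp: S subset_iff)
    then show "openin Y (?k -` S \<inter> topspace Y)"
      using U by simp
  next
    \<comment> \<open>The union of the subbasis is the whole space \<open>cont_maps X Y\<close>, so
      this only asks that constant maps lie there.\<close>
    show "?k ` topspace Y \<subseteq> \<Union> {{g \<in> cont_maps X Y. g ` K \<subseteq> U} | K U. compactin X K \<and> openin Y U}"
      using k topspace_compact_open_topology [of X Y]
      unfolding compact_open_topology_def topology_generated_by_topspace by blast
  qed
qed

lemma continuous_map_constant_path_section:
  assumes "continuous_map X Y f"
  shows "continuous_map X (path_fibration_space X Y f) (\<lambda>x. (x, restrict (\<lambda>t. f x) {0..1}))"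
proof -
  have "continuous_map X (path_mapping_space Y) (\<lambda>x. restrict (\<lambda>t. f x) {0..1})"
    using continuous_map_compose [OF assms continuous_map_constant_maps [of Y "top_of_set {0..1}"]]
    by (simp add: path_mapping_space_def comp_def)
  then show ?thesis
    by (auto simp: path_fibration_space_def continuous_map_in_subtopology continuous_map_paired)
qed

lemma continuous_map_fst_path_fibration_space:
  "continuous_map (path_fibration_space X Y f) X fst"
  unfolding path_fibration_space_def
  by (intro continuous_map_from_subtopology continuous_map_fst)

lemma homotopic_path_fibration:
  "homotopic_with (\<lambda>h. True) (path_fibration_space X Y f) Y path_fibration (f \<circ> fst)"
proof -
  let ?E = "path_fibration_space X Y f"
  \<comment> \<open>The homotopy sends (t, (x, \<gamma>)) to \<gamma> t; it is evaluation after the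
    projection forgetting x.\<close>
  have "continuous_map (prod_topology (top_of_set {0..1}) ?E) Y
      ((\<lambda>(t, \<gamma>). \<gamma> t) \<circ> (\<lambda>p. (fst p, snd (snd p))))"
  proof (rule continuous_map_compose [OF _ continuous_map_path_evaluation])
    have "continuous_map ?E (path_mapping_space Y) snd"
      unfolding path_fibration_space_def
      by (intro continuous_map_from_subtopology continuous_map_snd)
    then have "continuous_map (prod_topology (top_of_set {0..1}) ?E) (path_mapping_space Y) (snd \<circ> snd)"
      by (rule continuous_map_compose [OF continuous_map_snd])
    then show "continuous_map (prod_topology (top_of_set {0..1}) ?E)
        (prod_topology (top_of_set {0..1}) (path_mapping_space Y)) (\<lambda>p. (fst p, snd (snd p)))"
      by (simp add: continuous_map_paired continuous_map_fst comp_def)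
  qed
  then have "homotopic_with (\<lambda>h. True) ?E Y (\<lambda>p. snd p 0) (\<lambda>p. snd p 1)"
    unfolding homotopic_with_def by (intro exI conjI) auto
  \<comment> \<open>At time 0 the homotopy agrees with \<open>f \<circ> fst\<close> only on the
    points of \<open>?E\<close>, where \<gamma> 0 = f x by construction.\<close>
  then have "homotopic_with (\<lambda>h. True) ?E Y (f \<circ> fst) path_fibration"
    by (rule homotopic_with_eq) (auto simp: path_fibration_space_def path_fibration_def)
  then show ?thesis
    by (simp add: homotopic_with_symD)
qed

theorem mainTheorem11:
  fixes X :: "'a topology" and Y :: "'b topology" and f :: "'a \<Rightarrow> 'b"
  assumes "continuous_map X Y f"
  shows "map_category X Y f = map_category (path_fibration_space X Y f) Y path_fibration"
proof -
  let ?E = "path_fibration_space X Y f"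
  let ?s = "\<lambda>x. (x, restrict (\<lambda>t. f x) {0..1::real})"
  have "path_fibration \<circ> ?s = f"
    by (auto simp: path_fibration_def)
  then have "homotopic_with (\<lambda>h. True) X Y f (path_fibration \<circ> ?s)"
    using assms by simp
  \<comment> \<open>One pullback along the section and one along \<open>fst\<close> give the
    equivalence for every n, so the two categories agree in the infinite case as well.\<close>
  then have "has_categorical_cover X Y f n \<longleftrightarrow> has_categorical_cover ?E Y path_fibration n" for n
    using has_categorical_cover_pullback
        [OF _ continuous_map_constant_path_section [OF assms], of Y path_fibration n f]
      has_categorical_cover_pullback
        [OF _ continuous_map_fst_path_fibration_space homotopic_path_fibration, of X Y f n]
    by blast
  then show ?thesis
    by (simp add: map_category_def)
qed

end
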